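(* Let $(\mathcal{M},d)$ be a compact metric space with $\max_{x,y\in\mathcal{M}} d(x,y)=1$, and let $L$ be the set of all $1$-Lipschitz functions $f:\mathcal{M}\to\mathbb{R}$. Let $A^*=(p^*,g^* )$ be an optimal randomized sampling algorithm, i.e. one minimizing the worst-case error $\sup_{f\in L} E(f,A)$ over all randomized sampling algorithms $A$. Then for every $\epsilon>0$ there is a randomized sampling algorithm $A=(p,\mathrm{id})$, with $\mathrm{id}(x,y)=y$ for all $x,y$, such that $\sup_{f\in L}E(f,A)\le \sup_{f\in L}E(f,A^* )+\epsilon$.
   Context: The average of $f$ is $\mathrm{Avg}(f)=\int_{\mathcal{M}} f(x)\,dx$ with respect to the normalized (probability) measure on $\mathcal{M}$; when $\mathcal{M}$ is finite with $n$ points this is $\frac1n\sum_x f(x)$. A randomized sampling algorithm is a pair $A=(p,g)$ where $p$ is a probability density (a probability distribution if $\mathcal{M}$ is finite) on $\mathcal{M}$ and $g:\mathcal{M}\times\mathbb{R}\to\mathbb{R}$ is a prediction function: the algorithm samples $x\sim p$, observes $f(x)$ and outputs $g(x,f(x))$. Its error on $f$ is $E(f,A)=\int_x p(x)\,|\mathrm{Avg}(f)-g(x,f(x))|\,dx$ (a sum over points if $\mathcal{M}$ is finite). *)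

theory Defs
  imports "HOL-Analysis.Analysis"
begin

text \<open>
  The metric space is a subset \<open>M\<close> of a type of class \<open>metric_space\<close> with the restricted distance.
  Its normalized measure \<open>\<mu>\<close> is an arbitrary Borel probability measure if \<open>M\<close> is infinite, and the
  uniform distribution if \<open>M\<close> is finite.
\<close>

definition normalized_measure_on :: "'a::metric_space set \<Rightarrow> 'a measure \<Rightarrow> bool" where
  "normalized_measure_on M \<mu> \<longleftrightarrow>
     sets \<mu> = sets (restrict_space borel M) \<and> emeasure \<mu> (space \<mu>) = 1 \<and>
     (finite M \<longrightarrow> \<mu> = uniform_count_measure M)"

definition Lip1 :: "'a::metric_space set \<Rightarrow> ('a \<Rightarrow> real) set" where
  "Lip1 M = {f. 1-lipschitz_on M f}"

definition Avg :: "'a measure \<Rightarrow> ('a \<Rightarrow> real) \<Rightarrow> real" where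
  "Avg \<mu> f = (LINT x|\<mu>. f x)"

text \<open>
  The measure with respect to which \<open>p\<close> is a density. Counting measure on a finite \<open>M\<close> makes \<open>p\<close> an
  ordinary probability distribution, and turns the integrals below into sums over points.
\<close>

definition sampling_base :: "'a set \<Rightarrow> 'a measure \<Rightarrow> 'a measure" where
  "sampling_base M \<mu> = (if finite M then count_space M else \<mu>)"

definition is_sampling_density :: "'a set \<Rightarrow> 'a measure \<Rightarrow> ('a \<Rightarrow> real) \<Rightarrow> bool" where
  "is_sampling_density M \<mu> p \<longleftrightarrow>
     p \<in> borel_measurable (sampling_base M \<mu>) \<and> (\<forall>x\<in>M. 0 \<le> p x) \<and>
     (\<integral>\<^sup>+ x. ennreal (p x) \<partial>sampling_base M \<mu>) = 1"

text \<open>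
  The prediction function of an algorithm \<open>(p, g)\<close> is jointly Borel measurable if \<open>M\<close> is infinite,
  so that its error is an integral of a measurable function, and is arbitrary if \<open>M\<close> is finite.
\<close>

type_synonym 'a algorithm = "('a \<Rightarrow> real) \<times> ('a \<times> real \<Rightarrow> real)"

definition sampling_algorithm :: "'a set \<Rightarrow> 'a measure \<Rightarrow> 'a algorithm \<Rightarrow> bool" where
  "sampling_algorithm M \<mu> = (\<lambda>(p, g).
     is_sampling_density M \<mu> p \<and>
     (infinite M \<longrightarrow> g \<in> borel_measurable (\<mu> \<Otimes>\<^sub>M borel)))"

text \<open>Errors live in \<open>ennreal\<close>, since the error of a poor algorithm may be infinite.\<close>

definition Err :: "'a set \<Rightarrow> 'a measure \<Rightarrow> ('a \<Rightarrow> real) \<Rightarrow> 'a algorithm \<Rightarrow> ennreal" where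
  "Err M \<mu> f = (\<lambda>(p, g).
     \<integral>\<^sup>+ x. ennreal (p x * \<bar>Avg \<mu> f - g (x, f x)\<bar>) \<partial>sampling_base M \<mu>)"

definition worst_case_error :: "'a::metric_space set \<Rightarrow> 'a measure \<Rightarrow> 'a algorithm \<Rightarrow> ennreal" where
  "worst_case_error M \<mu> A = (SUP f\<in>Lip1 M. Err M \<mu> f A)"

definition optimal_algorithm :: "'a::metric_space set \<Rightarrow> 'a measure \<Rightarrow> 'a algorithm \<Rightarrow> bool" where
  "optimal_algorithm M \<mu> A \<longleftrightarrow>
     sampling_algorithm M \<mu> A \<and>
     (\<forall>B. sampling_algorithm M \<mu> B \<longrightarrow> worst_case_error M \<mu> A \<le> worst_case_error M \<mu> B)"

lemma Avg_finite:
  assumes "finite M" "normalized_measure_on M \<mu>"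
  shows "Avg \<mu> f = (\<Sum>x\<in>M. f x) / real (card M)"
proof -
  have "\<mu> = point_measure M (\<lambda>x. ennreal (1 / real (card M)))"
    using assms by (simp add: normalized_measure_on_def uniform_count_measure_def)
  then show ?thesis
    using assms(1) by (simp add: Avg_def lebesgue_integral_point_measure_finite sum_divide_distrib)
qed

lemma is_sampling_density_finite:
  assumes "finite M"
  shows "is_sampling_density M \<mu> p \<longleftrightarrow> (\<forall>x\<in>M. 0 \<le> p x) \<and> (\<Sum>x\<in>M. p x) = 1"
  using assms
  by (auto simp: is_sampling_density_def sampling_base_def nn_integral_count_space_finite sum_nonneg)

lemma Err_finite:
  assumes "finite M" "is_sampling_density M \<mu> p"
  shows "Err M \<mu> f (p, g) = ennreal (\<Sum>x\<in>M. p x * \<bar>Avg \<mu> f - g (x, f x)\<bar>)"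
  using assms
  by (simp add: is_sampling_density_finite Err_def sampling_base_def nn_integral_count_space_finite)

end

theory Submission
  imports Defs
begin

text \<open>
  For every sampling density \<open>p\<close> the identity is an optimal prediction function, because \<open>L\<close> is
  closed under adding constants and under negation. For \<open>f\<close> in \<open>L\<close>, the algorithm observes the same
  value at \<open>x\<close> on \<open>f + c\<close> and on \<open>- f + (c + 2 f(x))\<close>, while the quantities to be predicted differ by
  \<open>2 (Avg f - f(x))\<close>; hence its two errors at \<open>x\<close> add up to at least \<open>2 \<bar>Avg f - f(x)\<bar>\<close>. The shift
  \<open>2 f(x)\<close> depends on \<open>x\<close>, but it disappears in the limit if \<open>c\<close> is averaged over large sets that
  are almost invariant under all these shifts: long intervals if \<open>g\<close> is measurable, and large boxes
  in the group generated by the numbers \<open>2 f(x)\<close> if \<open>M\<close> is finite and \<open>g\<close> is arbitrary.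
\<close>

section \<open>Elementary inequalities and averaging over boxes of multi-indices\<close>

lemma le_if_scaled_le:
  fixes e w B :: real
  assumes "\<And>N. N > B \<Longrightarrow> (N - B) * e \<le> N * w"
  shows "e \<le> w"
proof (rule ccontr)
  assume "\<not> e \<le> w"
  then have pos: "e - w > 0" by simp
  \<comment> \<open>The first entry gives \<open>N > B\<close>. The second gives
    \<open>N * (e - w) > B * e\<close>, which is the negation of the scaled inequality at
    \<open>N\<close>.\<close>
  define N where "N = max (B + 1) ((B * e + 1) / (e - w))"
  have "(B * e + 1) / (e - w) \<le> N"
    by (simp add: N_def)
  then have "B * e + 1 \<le> N * (e - w)"
    using pos by (simp add: pos_divide_le_eq)
  moreover have "(N - B) * e \<le> N * w"
    by (rule assms) (simp add: N_def)
  ultimately show False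
    by (simp add: algebra_simps)
qed

text \<open>Triangle inequality: the two terms inside the right-hand absolute values differ by
  \<open>2 * (A - s)\<close>. Here \<open>y\<close> is the common prediction for two functions with
  the same value at the sampled point.\<close>

lemma two_abs_diff_le:
  fixes A s c y :: real
  shows "2 * \<bar>A - s\<bar> \<le> \<bar>A + c - y\<bar> + \<bar>c + 2 * s - A - y\<bar>"
  by (simp add: abs_if)

text \<open>Counts the multi-indices of a box that stay in it when coordinate \<open>x\<close> is
  raised by one.\<close>

lemma card_PiE_restrict_coordinate:
  assumes "finite M" "x \<in> M"
  shows "card (PiE M (\<lambda>y. if y = x then {..<N} else {..N})) = N * Suc N ^ (card M - 1)"
proof -
  have "card (PiE M (\<lambda>y. if y = x then {..<N} else {..N}))
      = (\<Prod>y\<in>M. if y = x then N else Suc N)"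
    using assms(1) by (simp add: card_PiE if_distrib cong: if_cong)
  also have "\<dots> = N * (\<Prod>y\<in>M - {x}. if y = x then N else Suc N)"
    using assms by (simp add: prod.remove)
  also have "(\<Prod>y\<in>M - {x}. if y = x then N else Suc N) = (\<Prod>y\<in>M - {x}. Suc N)"
    by (rule prod.cong) auto
  also have "\<dots> = Suc N ^ (card M - 1)"
    using assms by simp
  finally show ?thesis .
qed

text \<open>Parametrize \<open>c\<close> by the integer combinations of the shifts
  \<open>t y\<close> with coefficients in \<open>{..N}\<close>. Shifting by \<open>t x\<close>
  raises one coefficient, which leaves the box only for a fraction 1/(N+1) of it. Averaging the
  pointwise bound \<open>v\<close> over the box therefore costs a factor (N+1)/N, which tends to
  1.\<close>

lemma box_averaging:
  fixes a b :: "'a \<Rightarrow> real \<Rightarrow> real" and p v t :: "'a \<Rightarrow> real" and w :: real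
  assumes fin: "finite M"
    and p: "\<And>x. x \<in> M \<Longrightarrow> 0 \<le> p x"
    and a: "\<And>x c. 0 \<le> a x c" and b: "\<And>x c. 0 \<le> b x c"
    and aw: "\<And>c. (\<Sum>x\<in>M. p x * a x c) \<le> w"
    and bw: "\<And>c. (\<Sum>x\<in>M. p x * b x c) \<le> w"
    and v: "\<And>x c. x \<in> M \<Longrightarrow> 2 * v x \<le> a x c + b x (c + t x)"
  shows "(\<Sum>x\<in>M. p x * v x) \<le> w"
\<comment> \<open>The empty case is split off because \<open>card M - 1\<close> truncates at 0, so
  that the formula for \<open>card F\<close> below would fail.\<close>
proof (cases "M = {}")
  case True
  then show ?thesis using aw[of 0] by simp
next
  case False
  let ?S = "\<Sum>x\<in>M. p x * v x"
  have step: "real N * ?S \<le> real (Suc N) * w" for N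
  proof -
    \<comment> \<open>\<open>F\<close> is the full box and \<open>G x\<close> the part with room to
      raise coordinate \<open>x\<close>. All sums run over indices \<open>n\<close>, not over values
      \<open>c n\<close>, so coincidences among the combinations do no harm.\<close>
    define F where "F = PiE M (\<lambda>_. {..N})"
    define G where "G x = PiE M (\<lambda>y. if y = x then {..<N} else {..N})" for x
    define c where "c n = (\<Sum>y\<in>M. real (n y) * t y)" for n :: "'a \<Rightarrow> nat"
    let ?s = "\<lambda>x n. n(x := Suc (n x))"
    have finF: "finite F"
      unfolding F_def using fin by (intro finite_PiE) auto
    have cardF: "real (card F) = real (Suc N) * real (Suc N) ^ (card M - 1)"
      using fin False by (cases "card M") (auto simp: F_def card_PiE algebra_simps)
    have cardG: "real (card (G x)) = real N * real (Suc N) ^ (card M - 1)" if "x \<in> M" for x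
      unfolding G_def card_PiE_restrict_coordinate[OF fin that] by simp
    have GF: "G x \<subseteq> F" for x
      unfolding G_def F_def by (intro PiE_mono) auto
    have sF: "?s x ` G x \<subseteq> F" if "x \<in> M" for x
      using that unfolding G_def F_def
      by (fastforce simp: PiE_iff extensional_def split: if_splits)
    have inj: "inj_on (?s x) (G x)" for x
    proof (rule inj_onI)
      fix m n assume eq: "?s x m = ?s x n"
      show "m = n"
      proof
        fix y show "m y = n y"
          using fun_cong[OF eq, of y] by (cases "y = x") auto
      qed
    qed
    have cs: "c (?s x n) = c n + t x" if "x \<in> M" for x n
    proof -
      have "(\<Sum>y\<in>M - {x}. real (?s x n y) * t y) = (\<Sum>y\<in>M - {x}. real (n y) * t y)"
        by (rule sum.cong) auto
      then show ?thesis
        unfolding c_def using fin that by (simp add: sum.remove[of M x] algebra_simps)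
    qed
    have point: "real (card (G x)) * (2 * v x) \<le> (\<Sum>n\<in>F. a x (c n)) + (\<Sum>n\<in>F. b x (c n))"
      if x: "x \<in> M" for x
    proof -
      have "real (card (G x)) * (2 * v x) \<le> (\<Sum>n\<in>G x. a x (c n) + b x (c n + t x))"
        using v[OF x] by (intro sum_bounded_below) auto
      also have "\<dots> = (\<Sum>n\<in>G x. a x (c n)) + (\<Sum>n\<in>?s x ` G x. b x (c n))"
        by (simp only: sum.reindex[OF inj] o_def cs[OF x] sum.distrib)
      also have "\<dots> \<le> (\<Sum>n\<in>F. a x (c n)) + (\<Sum>n\<in>F. b x (c n))"
        using finF GF sF[OF x] a b by (intro add_mono sum_mono2) auto
      finally show ?thesis .
    qed
    \<comment> \<open>The power is common to the sizes of \<open>G x\<close> and \<open>F\<close>;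
      it is carried through the double counting and cancelled at the end.\<close>
    have "real (Suc N) ^ (card M - 1) * (2 * (real N * ?S))
        = (\<Sum>x\<in>M. p x * (real (card (G x)) * (2 * v x)))"
      by (simp add: sum_distrib_left cardG mult_ac)
    also have "\<dots> \<le> (\<Sum>x\<in>M. p x * ((\<Sum>n\<in>F. a x (c n)) + (\<Sum>n\<in>F. b x (c n))))"
      by (intro sum_mono mult_left_mono point p)
    also have "\<dots> = (\<Sum>n\<in>F. (\<Sum>x\<in>M. p x * a x (c n)) + (\<Sum>x\<in>M. p x * b x (c n)))"
      by (simp add: distrib_left sum_distrib_left sum.distrib sum.swap[of _ F M])
    also have "\<dots> \<le> real (card F) * (2 * w)"
    proof (rule sum_bounded_above)
      fix n
      show "(\<Sum>x\<in>M. p x * a x (c n)) + (\<Sum>x\<in>M. p x * b x (c n)) \<le> 2 * w"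
        using aw[of "c n"] bw[of "c n"] by linarith
    qed
    also have "\<dots> = real (Suc N) ^ (card M - 1) * (2 * (real (Suc N) * w))"
      by (simp add: cardF mult_ac)
    finally show ?thesis
      by (simp del: of_nat_Suc)
  qed
  show ?thesis
  proof (rule ccontr)
    assume "\<not> ?S \<le> w"
    \<comment> \<open>Contradicts \<open>step\<close>, which rearranges to
      \<open>N * (?S - w) \<le> w\<close> for every \<open>N\<close>.\<close>
    then obtain N where "real N * (?S - w) > w"
      using reals_Archimedean3[of "?S - w"] by auto
    then show False
      using step[of N] by (simp add: algebra_simps)
  qed
qed

section \<open>Lipschitz functions, their averages, and error bounds for shifts and
  reflections\<close>

lemma Lip1_add_const: "f \<in> Lip1 M \<Longrightarrow> (\<lambda>x. f x + c) \<in> Lip1 M"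
  by (auto simp: Lip1_def lipschitz_on_def dist_real_def)

lemma Lip1_uminus: "f \<in> Lip1 M \<Longrightarrow> (\<lambda>x. - f x) \<in> Lip1 M"
  by (auto simp: Lip1_def lipschitz_on_def dist_real_def abs_minus_commute)

lemma normalized_measure_on_space: "normalized_measure_on M \<mu> \<Longrightarrow> space \<mu> = M"
  using sets_eq_imp_space_eq[of \<mu> "restrict_space borel M"]
  by (simp add: normalized_measure_on_def space_restrict_space)

lemma normalized_measure_on_finite_measure: "normalized_measure_on M \<mu> \<Longrightarrow> finite_measure \<mu>"
  by (intro finite_measureI) (simp add: normalized_measure_on_def)

lemma Lip1_measurable:
  assumes "normalized_measure_on M \<mu>" "f \<in> Lip1 M"
  shows "f \<in> borel_measurable \<mu>"
proof -
  have "continuous_on M f"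
    using assms(2) by (auto simp: Lip1_def intro: lipschitz_on_continuous_on)
  then have "f \<in> borel_measurable (restrict_space borel M)"
    by (rule borel_measurable_continuous_on_restrict)
  moreover have "sets \<mu> = sets (restrict_space borel M)"
    using assms(1) by (simp add: normalized_measure_on_def)
  ultimately show ?thesis
    by (simp cong: measurable_cong_sets)
qed

lemma Lip1_bounded:
  assumes "compact M" "f \<in> Lip1 M"
  obtains B where "B > 0" "\<And>x. x \<in> M \<Longrightarrow> \<bar>f x\<bar> \<le> B"
proof -
  have "continuous_on M f"
    using assms(2) by (auto simp: Lip1_def intro: lipschitz_on_continuous_on)
  then have "bounded (f ` M)"
    using assms(1) compact_continuous_image compact_imp_bounded by blast
  then show thesis
    using that by (auto simp: bounded_pos)
qed

lemma Lip1_integrable: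
  assumes "compact M" "normalized_measure_on M \<mu>" "f \<in> Lip1 M"
  shows "integrable \<mu> f"
proof -
  obtain B where "\<And>x. x \<in> M \<Longrightarrow> \<bar>f x\<bar> \<le> B"
    using Lip1_bounded[OF assms(1,3)] by blast
  then show ?thesis
    using normalized_measure_on_space[OF assms(2)] Lip1_measurable[OF assms(2,3)]
    by (intro finite_measure.integrable_const_bound[where B = B]
          normalized_measure_on_finite_measure[OF assms(2)]) auto
qed

lemma Avg_add_const:
  assumes "normalized_measure_on M \<mu>" "integrable \<mu> f"
  shows "Avg \<mu> (\<lambda>x. f x + c) = Avg \<mu> f + c"
proof -
  interpret finite_measure \<mu>
    by (rule normalized_measure_on_finite_measure[OF assms(1)])
  have "measure \<mu> (space \<mu>) = 1"
    using assms(1) by (simp add: normalized_measure_on_def measure_def)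
  then show ?thesis
    using assms(2) by (simp add: Avg_def)
qed

lemma Avg_uminus: "Avg \<mu> (\<lambda>x. - f x) = - Avg \<mu> f"
  by (simp add: Avg_def)

lemma Err_le_worst_case_error: "f \<in> Lip1 M \<Longrightarrow> Err M \<mu> f A \<le> worst_case_error M \<mu> A"
  unfolding worst_case_error_def by (rule SUP_upper)

lemma Err_shift_le:
  assumes "compact M" "normalized_measure_on M \<mu>" "f \<in> Lip1 M"
  shows "(\<integral>\<^sup>+ x. ennreal (p x * \<bar>Avg \<mu> f + c - g (x, f x + c)\<bar>) \<partial>sampling_base M \<mu>)
      \<le> worst_case_error M \<mu> (p, g)"
  using Err_le_worst_case_error[OF Lip1_add_const[OF assms(3)], of \<mu> c "(p, g)"]
    Avg_add_const[OF assms(2) Lip1_integrable[OF assms]]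
  by (simp add: Err_def)

text \<open>The shift bound applied to \<open>- f\<close>. With \<open>c + 2 * f x\<close> in place
  of \<open>c\<close>, the value observed at \<open>x\<close> is \<open>f x + c\<close>, the same as
  for the shifted \<open>f\<close>.\<close>

lemma Err_reflect_shift_le:
  assumes "compact M" "normalized_measure_on M \<mu>" "f \<in> Lip1 M"
  shows "(\<integral>\<^sup>+ x. ennreal (p x * \<bar>c - Avg \<mu> f - g (x, c - f x)\<bar>) \<partial>sampling_base M \<mu>)
      \<le> worst_case_error M \<mu> (p, g)"
  using Err_shift_le[OF assms(1,2) Lip1_uminus[OF assms(3)], of p c g]
  by (simp add: Avg_uminus)

section \<open>Finite spaces with arbitrary prediction functions\<close>

lemma Err_id_le_finite:
  assumes "finite M" "normalized_measure_on M \<mu>" "f \<in> Lip1 M" "is_sampling_density M \<mu> p"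
  shows "Err M \<mu> f (p, \<lambda>(x, y). y) \<le> worst_case_error M \<mu> (p, g)"
proof (cases "worst_case_error M \<mu> (p, g)")
  case (real w)
  have p: "0 \<le> p x" if "x \<in> M" for x
    using assms(4) that by (simp add: is_sampling_density_def)
  have integral: "(\<integral>\<^sup>+ x. ennreal (p x * \<bar>h x\<bar>) \<partial>sampling_base M \<mu>) = ennreal (\<Sum>x\<in>M. p x * \<bar>h x\<bar>)"
    for h :: "'a \<Rightarrow> real"
    using assms(1) p by (simp add: sampling_base_def nn_integral_count_space_finite)
  have "(\<Sum>x\<in>M. p x * \<bar>Avg \<mu> f - f x\<bar>) \<le> w"
  \<comment> \<open>\<open>a\<close> and \<open>b\<close> are the pointwise errors on f + c and on -
    f + c; the shift \<open>2 * f x\<close> makes their observations at \<open>x\<close>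
    agree.\<close>
  proof (rule box_averaging[where t = "\<lambda>x. 2 * f x"
        and a = "\<lambda>x c. \<bar>Avg \<mu> f + c - g (x, f x + c)\<bar>"
        and b = "\<lambda>x c. \<bar>c - Avg \<mu> f - g (x, c - f x)\<bar>"])
    fix c
    show "(\<Sum>x\<in>M. p x * \<bar>Avg \<mu> f + c - g (x, f x + c)\<bar>) \<le> w"
      using Err_shift_le[OF finite_imp_compact[OF assms(1)] assms(2,3), of p c g] real
      by (simp add: integral)
    show "(\<Sum>x\<in>M. p x * \<bar>c - Avg \<mu> f - g (x, c - f x)\<bar>) \<le> w"
      using Err_reflect_shift_le[OF finite_imp_compact[OF assms(1)] assms(2,3), of p c g] real
      by (simp add: integral)
  next
    fix x c
    have "c + 2 * f x - f x = f x + c" by simp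
    then show "2 * \<bar>Avg \<mu> f - f x\<bar> \<le> \<bar>Avg \<mu> f + c - g (x, f x + c)\<bar>
        + \<bar>c + 2 * f x - Avg \<mu> f - g (x, c + 2 * f x - f x)\<bar>"
      using two_abs_diff_le[of "Avg \<mu> f" "f x" c "g (x, f x + c)"] by (simp only:)
  qed (use assms(1) p in auto)
  then show ?thesis
    using real by (simp add: Err_def integral ennreal_leI)
qed simp

section \<open>Infinite spaces: averaging over long intervals\<close>

lemma interval_averaging:
  fixes a b :: "real \<Rightarrow> real"
  assumes [measurable]: "a \<in> borel_measurable borel" "b \<in> borel_measurable borel"
    and ab: "\<And>c. 2 * v \<le> \<bar>a c\<bar> + \<bar>b (c + 2 * s)\<bar>"
    and v: "0 \<le> v" and s: "\<bar>s\<bar> \<le> B" and N: "N \<ge> B"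
  shows "ennreal (4 * (N - B)) * ennreal v
    \<le> (\<integral>\<^sup>+ c. (ennreal \<bar>a c\<bar> + ennreal \<bar>b c\<bar>) * indicator {-N..N} c \<partial>lborel)"
proof -
  \<comment> \<open>Centred at \<open>- s\<close>, so that \<open>c\<close> and
    \<open>c + 2 * s\<close> both lie in \<open>{-N..N}\<close> for \<open>c\<close> in
    \<open>J\<close>, as \<bar>s\<bar> \<le> B. Its length \<open>2 * (N - B)\<close> is the same
    for all \<open>s\<close>, which later makes the bound uniform in \<open>x\<close>.\<close>
  define J where "J = {- N + B - s .. N - B - s}"
  have "ennreal (4 * (N - B)) * ennreal v = (\<integral>\<^sup>+ c. ennreal (2 * v) * indicator J c \<partial>lborel)"
    using N v by (simp add: J_def nn_integral_cmult_indicator algebra_simps flip: ennreal_mult)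
  also have "\<dots> \<le> (\<integral>\<^sup>+ c. ennreal \<bar>a c\<bar> * indicator {-N..N} c
        + ennreal \<bar>b (2 * s + 1 * c)\<bar> * indicator {-N..N} (2 * s + 1 * c) \<partial>lborel)"
  proof (rule nn_integral_mono)
    fix c :: real
    show "ennreal (2 * v) * indicator J c \<le> ennreal \<bar>a c\<bar> * indicator {-N..N} c
        + ennreal \<bar>b (2 * s + 1 * c)\<bar> * indicator {-N..N} (2 * s + 1 * c)"
    proof (cases "c \<in> J")
      case True
      then have "c \<in> {-N..N}" "2 * s + 1 * c \<in> {-N..N}"
        using s by (auto simp: J_def)
      then show ?thesis
        using True ab[of c] by (simp add: add.commute ennreal_leI flip: ennreal_plus)
    qed simp
  qed
  also have "\<dots> = (\<integral>\<^sup>+ c. ennreal \<bar>a c\<bar> * indicator {-N..N} c \<partial>lborel)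
      + (\<integral>\<^sup>+ c. ennreal \<bar>b (2 * s + 1 * c)\<bar> * indicator {-N..N} (2 * s + 1 * c) \<partial>lborel)"
    by (rule nn_integral_add) measurable
  \<comment> \<open>Translation invariance of Lebesgue measure; the factor 1 in the argument was
    written to fit the affine substitution rule.\<close>
  also have "(\<integral>\<^sup>+ c. ennreal \<bar>b (2 * s + 1 * c)\<bar> * indicator {-N..N} (2 * s + 1 * c) \<partial>lborel)
      = (\<integral>\<^sup>+ c. ennreal \<bar>b c\<bar> * indicator {-N..N} c \<partial>lborel)"
    by (subst nn_integral_real_affine[where c = 1 and t = "2 * s"]) auto
  also have "(\<integral>\<^sup>+ c. ennreal \<bar>a c\<bar> * indicator {-N..N} c \<partial>lborel) + \<dots>
      = (\<integral>\<^sup>+ c. (ennreal \<bar>a c\<bar> + ennreal \<bar>b c\<bar>) * indicator {-N..N} c \<partial>lborel)"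
    by (simp add: distrib_right nn_integral_add)
  finally show ?thesis .
qed

lemma Err_id_le_infinite:
  assumes "compact M" "infinite M" "normalized_measure_on M \<mu>" "f \<in> Lip1 M"
    and "is_sampling_density M \<mu> p" and g[measurable]: "g \<in> borel_measurable (\<mu> \<Otimes>\<^sub>M borel)"
  shows "Err M \<mu> f (p, \<lambda>(x, y). y) \<le> worst_case_error M \<mu> (p, g)"
proof (cases "worst_case_error M \<mu> (p, g)")
  case (real w)
  interpret finite_measure \<mu>
    by (rule normalized_measure_on_finite_measure[OF assms(3)])
  interpret pair_sigma_finite \<mu> lborel ..
  have space: "space \<mu> = M"
    by (rule normalized_measure_on_space[OF assms(3)])
  have base: "sampling_base M \<mu> = \<mu>"
    using assms(2) by (simp add: sampling_base_def)
  have [measurable]: "f \<in> borel_measurable \<mu>"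
    by (rule Lip1_measurable[OF assms(3,4)])
  have [measurable]: "p \<in> borel_measurable \<mu>"
    using assms(5) by (simp add: is_sampling_density_def base)
  have p: "0 \<le> p x" if "x \<in> M" for x
    using assms(5) that by (simp add: is_sampling_density_def)
  obtain B where B: "B > 0" "\<And>x. x \<in> M \<Longrightarrow> \<bar>f x\<bar> \<le> B"
    using Lip1_bounded[OF assms(1,4)] by blast
  let ?E = "Err M \<mu> f (p, \<lambda>(x, y). y)"
  let ?a = "\<lambda>x c. Avg \<mu> f + c - g (x, f x + c)"
  let ?b = "\<lambda>x c. c - Avg \<mu> f - g (x, c - f x)"
  \<comment> \<open>Integrate the sum of the two errors over \<open>x\<close> and over
    \<open>c\<close> in \<open>{-N..N}\<close>. Integrating over \<open>c\<close> first bounds it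
    below by the left side; integrating over \<open>x\<close> first bounds it above by
    \<open>2 * w\<close> times the length \<open>2 * N\<close>.\<close>
  have scaled: "ennreal (4 * (N - B)) * ?E \<le> ennreal (4 * N * w)" if N: "N > B" for N
  proof -
    have "ennreal (4 * (N - B)) * ?E
        = (\<integral>\<^sup>+ x. ennreal (p x) * (ennreal (4 * (N - B)) * ennreal \<bar>Avg \<mu> f - f x\<bar>) \<partial>\<mu>)"
      unfolding Err_def base
      by (simp add: nn_integral_cmult[symmetric])
        (intro nn_integral_cong, simp add: space p ennreal_mult' mult_ac)
    also have "\<dots> \<le> (\<integral>\<^sup>+ x. ennreal (p x) *
        (\<integral>\<^sup>+ c. (ennreal \<bar>?a x c\<bar> + ennreal \<bar>?b x c\<bar>) * indicator {-N..N} c \<partial>lborel) \<partial>\<mu>)"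
    proof (intro nn_integral_mono mult_left_mono)
      fix x assume x: "x \<in> space \<mu>"
      have [measurable]: "(\<lambda>y. g (x, y)) \<in> borel_measurable borel"
        using x by measurable
      show "ennreal (4 * (N - B)) * ennreal \<bar>Avg \<mu> f - f x\<bar>
          \<le> (\<integral>\<^sup>+ c. (ennreal \<bar>?a x c\<bar> + ennreal \<bar>?b x c\<bar>) * indicator {-N..N} c \<partial>lborel)"
      proof (rule interval_averaging[where s = "f x"])
        fix c
        have "c + 2 * f x - f x = f x + c" by simp
        then show "2 * \<bar>Avg \<mu> f - f x\<bar> \<le> \<bar>?a x c\<bar> + \<bar>?b x (c + 2 * f x)\<bar>"
          using two_abs_diff_le[of "Avg \<mu> f" "f x" c "g (x, f x + c)"] by (simp only:)
      qed (use N B x space in auto)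
    qed simp
    also have "\<dots> = (\<integral>\<^sup>+ x. \<integral>\<^sup>+ c. ennreal (p x) *
        ((ennreal \<bar>?a x c\<bar> + ennreal \<bar>?b x c\<bar>) * indicator {-N..N} c) \<partial>lborel \<partial>\<mu>)"
    proof (intro nn_integral_cong nn_integral_cmult[symmetric])
      fix x assume x: "x \<in> space \<mu>"
      have [measurable]: "(\<lambda>y. g (x, y)) \<in> borel_measurable borel"
        using x by measurable
      show "(\<lambda>c. (ennreal \<bar>?a x c\<bar> + ennreal \<bar>?b x c\<bar>) * indicator {-N..N} c)
          \<in> borel_measurable lborel"
        by measurable
    qed
    also have "\<dots> = (\<integral>\<^sup>+ c. \<integral>\<^sup>+ x. ennreal (p x) *
        ((ennreal \<bar>?a x c\<bar> + ennreal \<bar>?b x c\<bar>) * indicator {-N..N} c) \<partial>\<mu> \<partial>lborel)"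
      \<comment> \<open>The joint measurability of \<open>g\<close> enters here.\<close>
      by (rule Fubini'[symmetric]) measurable
    also have "\<dots> \<le> (\<integral>\<^sup>+ c. ennreal (2 * w) * indicator {-N..N} c \<partial>lborel)"
    proof (rule nn_integral_mono)
      fix c :: real
      have "(\<integral>\<^sup>+ x. ennreal (p x) *
            ((ennreal \<bar>?a x c\<bar> + ennreal \<bar>?b x c\<bar>) * indicator {-N..N} c) \<partial>\<mu>)
          = (\<integral>\<^sup>+ x. (ennreal (p x * \<bar>?a x c\<bar>) + ennreal (p x * \<bar>?b x c\<bar>))
              * indicator {-N..N} c \<partial>\<mu>)"
        by (intro nn_integral_cong) (simp add: space p ennreal_mult' distrib_left distrib_right mult.assoc)
      also have "\<dots> = ((\<integral>\<^sup>+ x. ennreal (p x * \<bar>?a x c\<bar>) \<partial>\<mu>)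
          + (\<integral>\<^sup>+ x. ennreal (p x * \<bar>?b x c\<bar>) \<partial>\<mu>)) * indicator {-N..N} c"
        by (simp add: nn_integral_multc nn_integral_add)
      also have "\<dots> \<le> (ennreal w + ennreal w) * indicator {-N..N} c"
        using Err_shift_le[OF assms(1,3,4), of p c g]
          Err_reflect_shift_le[OF assms(1,3,4), of p c g] real
        by (intro mult_right_mono add_mono) (simp_all add: base)
      also have "ennreal w + ennreal w = ennreal (2 * w)"
        using real by (simp flip: ennreal_plus)
      finally show "(\<integral>\<^sup>+ x. ennreal (p x) *
            ((ennreal \<bar>?a x c\<bar> + ennreal \<bar>?b x c\<bar>) * indicator {-N..N} c) \<partial>\<mu>)
          \<le> ennreal (2 * w) * indicator {-N..N} c" .
    qed
    also have "\<dots> = ennreal (4 * N * w)"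
      using N B real by (simp add: nn_integral_cmult_indicator algebra_simps flip: ennreal_mult)
    finally show ?thesis .
  qed
  show ?thesis
  \<comment> \<open>An infinite error is refuted by a single \<open>N\<close>, since the right side
    of \<open>scaled\<close> is finite; for a finite one \<open>N\<close> tends to infinity.\<close>
  proof (cases ?E)
    case top
    then show ?thesis
      using scaled[of "B + 1"] by (simp add: ennreal_mult_top top_unique)
  next
    case E: (real e)
    have "e \<le> w"
    proof (rule le_if_scaled_le)
      fix N assume N: "N > B"
      have "ennreal (4 * (N - B) * e) \<le> ennreal (4 * N * w)"
        using scaled[OF N] E N by (simp add: ennreal_mult)
      then show "(N - B) * e \<le> N * w"
        using N B real by (simp add: algebra_simps)
    qed
    then show ?thesis
      using E real by (simp add: ennreal_leI)
  qed
qed simp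

section \<open>Passage to the worst case and conclusion\<close>

lemma worst_case_error_id_le:
  assumes "compact M" "normalized_measure_on M \<mu>" "sampling_algorithm M \<mu> (p, g)"
  shows "worst_case_error M \<mu> (p, \<lambda>(x, y). y) \<le> worst_case_error M \<mu> (p, g)"
proof -
  have "Err M \<mu> f (p, \<lambda>(x, y). y) \<le> worst_case_error M \<mu> (p, g)" if "f \<in> Lip1 M" for f
    using assms that Err_id_le_finite[of M \<mu> f p g] Err_id_le_infinite[of M \<mu> f p g]
    by (cases "finite M") (auto simp: sampling_algorithm_def)
  then show ?thesis
    unfolding worst_case_error_def[of M \<mu> "(p, \<lambda>(x, y). y)"] by (intro SUP_least)
qed

theorem theorem2:
  fixes M :: "'a::metric_space set" and \<mu> :: "'a measure"
    and p_opt :: "'a \<Rightarrow> real" and g_opt :: "'a \<times> real \<Rightarrow> real"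
  assumes "compact M"
    and "\<forall>x\<in>M. \<forall>y\<in>M. dist x y \<le> 1"
    and "\<exists>x\<in>M. \<exists>y\<in>M. dist x y = 1"
    and "normalized_measure_on M \<mu>"
    and "optimal_algorithm M \<mu> (p_opt, g_opt)"
  shows "\<forall>\<epsilon>::real. \<epsilon> > 0 \<longrightarrow>
    (\<exists>p. sampling_algorithm M \<mu> (p, \<lambda>(x, y). y) \<and>
         worst_case_error M \<mu> (p, \<lambda>(x, y). y)
           \<le> worst_case_error M \<mu> (p_opt, g_opt) + ennreal \<epsilon>)"
proof (intro allI impI exI conjI)
  fix \<epsilon> :: real
  \<comment> \<open>The witness is the density of the optimal algorithm, for every \<epsilon>; only
    its prediction function is replaced.\<close>
  have alg: "sampling_algorithm M \<mu> (p_opt, g_opt)"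
    using assms(5) by (simp add: optimal_algorithm_def)
  then show "sampling_algorithm M \<mu> (p_opt, \<lambda>(x, y). y)"
    by (simp add: sampling_algorithm_def)
  show "worst_case_error M \<mu> (p_opt, \<lambda>(x, y). y)
      \<le> worst_case_error M \<mu> (p_opt, g_opt) + ennreal \<epsilon>"
    using worst_case_error_id_le[OF assms(1,4) alg] by (simp add: add_increasing2)
qed

end
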